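(* Consider the exponential family model for $X$ and $Y_1$ described in the context, reverse Kullback-Leibler loss, and a prior measure $\pi$ for $\eta$ such that the posterior distribution and expectation exist. Then the Bayes predictive density estimate $\hat q_\pi(\cdot;x)$ of $q_{\eta_1}$ is the plug-in density estimate $q_{\hat\eta_1(x)}(\cdot)$, with $\hat\eta_1(x)=\mathbb{E}_\pi(\eta_1\mid x)$ the posterior expectation of $\eta_1$.
   Context: Model: with respect to $\sigma$-finite measures $\mu_1$ and $\mu_2$ respectively, $X$ and $Y_1$ have densities in canonical exponential family form $$X\mid\eta\sim p_\eta(x)=h_1(x)\exp\{\eta_1^Ts_1(x)+\eta_2^Ts_2(x)-c_1(\eta)\},\qquad Y_1\mid\eta_1\sim q_{\eta_1}(y_1)=h_2(y_1)\exp\{\eta_1^Tt_1(y_1)-c_2(\eta_1)\},$$ where $X=(X_1,X_2)^T$, $\eta=(\eta_1,\eta_2)^T$, and $\eta_1,\eta_2,s_1(x),s_2(x),t_1(y_1)$ are vectors of dimension $p$. $X$ and $Y_1$ are independent given $\eta$, and one seeks a predictive density for $Y_1$ based on $X$, with or without additional information $\eta_1-\eta_2\in A$ (the prior $\pi$ may be supported on such a set). Reverse Kullback-Leibler loss: $L(\eta_1,\hat q)=\int\hat q(y_1)\log\frac{\hat q(y_1)}{q_{\eta_1}(y_1)}\,d\mu_2(y_1)$. The Bayes predictive density $\hat q_\pi(\cdot;x)$ is the density (with respect to $\mu_2$) minimizing the posterior expected loss given $X=x$. *)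

theory Defs
  imports "HOL-Probability.Probability"
begin

text \<open>
  Integral of an extended-real function as the difference of the integrals of its positive and
  negative parts; \<^const>\<open>e2ennreal\<close> truncates at \<open>0\<close>. Since \<open>\<infinity> - \<infinity> = \<infinity>\<close> in \<^typ>\<open>ereal\<close>, a loss with
  undefined integral counts as infinite (unlike the Bochner integral, which would return \<open>0\<close>).
\<close>
definition ereal_integral :: "'a measure \<Rightarrow> ('a \<Rightarrow> ereal) \<Rightarrow> ereal" where
  "ereal_integral M f =
     enn2ereal (\<integral>\<^sup>+ x. e2ennreal (f x) \<partial>M) - enn2ereal (\<integral>\<^sup>+ x. e2ennreal (- f x) \<partial>M)"

definition prob_density :: "'a measure \<Rightarrow> ('a \<Rightarrow> real) \<Rightarrow> bool" where
  "prob_density \<mu> f \<longleftrightarrow>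
     f \<in> borel_measurable \<mu> \<and> (\<forall>x\<in>space \<mu>. 0 \<le> f x) \<and> (\<integral>\<^sup>+ x. ennreal (f x) \<partial>\<mu>) = 1"

text \<open>
  Canonical exponential family with carrier \<open>h\<close>, statistic \<open>t\<close> and log-normalizer \<open>c\<close>. With a pair
  \<open>\<theta> = (\<eta>\<^sub>1, \<eta>\<^sub>2)\<close> and \<open>t x = (s\<^sub>1 x, s\<^sub>2 x)\<close> the inner product of the product space is
  \<open>\<eta>\<^sub>1 \<bullet> s\<^sub>1 x + \<eta>\<^sub>2 \<bullet> s\<^sub>2 x\<close>.
\<close>
definition exp_family ::
    "('a \<Rightarrow> real) \<Rightarrow> ('a \<Rightarrow> 'v::real_inner) \<Rightarrow> ('v \<Rightarrow> real) \<Rightarrow> 'v \<Rightarrow> 'a \<Rightarrow> real" where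
  "exp_family h t c \<theta> x = h x * exp (\<theta> \<bullet> t x - c \<theta>)"

definition natural_params ::
    "'a measure \<Rightarrow> ('a \<Rightarrow> real) \<Rightarrow> ('a \<Rightarrow> 'v::real_inner) \<Rightarrow> 'v set" where
  "natural_params \<mu> h t = {\<theta>. (\<integral>\<^sup>+ x. ennreal (h x * exp (\<theta> \<bullet> t x)) \<partial>\<mu>) < \<infinity>}"

definition marginal :: "'e measure \<Rightarrow> ('e \<Rightarrow> 'a \<Rightarrow> real) \<Rightarrow> 'a \<Rightarrow> ennreal" where
  "marginal \<pi> p x = (\<integral>\<^sup>+ \<eta>. ennreal (p \<eta> x) \<partial>\<pi>)"

text \<open>Bayes' formula. It is a probability distribution when \<open>0 < marginal \<pi> p x < \<infinity>\<close>, which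
  also covers improper (infinite) priors.\<close>
definition posterior :: "'e measure \<Rightarrow> ('e \<Rightarrow> 'a \<Rightarrow> real) \<Rightarrow> 'a \<Rightarrow> 'e measure" where
  "posterior \<pi> p x = density \<pi> (\<lambda>\<eta>. ennreal (p \<eta> x) / marginal \<pi> p x)"

text \<open>
  \<open>\<integral> q log (q / r) d\<mu>\<close> with \<open>0 log (0 / r) = 0\<close> and \<open>q log (q / 0) = \<infinity>\<close> for \<open>q > 0\<close>;
  \<open>r\<close> is the true density and \<open>q\<close> the estimate.
\<close>
definition reverse_KL_loss :: "'b measure \<Rightarrow> ('b \<Rightarrow> real) \<Rightarrow> ('b \<Rightarrow> real) \<Rightarrow> ereal" where
  "reverse_KL_loss \<mu> r q = ereal_integral \<mu>
     (\<lambda>y. if q y = 0 then 0 else if r y = 0 then \<infinity> else ereal (q y * ln (q y / r y)))"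

text \<open>In the next two definitions \<open>P\<close> is the posterior distribution of \<open>\<eta> = (\<eta>\<^sub>1, \<eta>\<^sub>2)\<close> and
  \<open>qf \<eta>\<^sub>1\<close> is the density of \<open>Y\<^sub>1\<close> given \<open>\<eta>\<^sub>1\<close>.\<close>
definition posterior_expected_loss ::
    "('v \<times> 'w) measure \<Rightarrow> 'b measure \<Rightarrow> ('v \<Rightarrow> 'b \<Rightarrow> real) \<Rightarrow> ('b \<Rightarrow> real) \<Rightarrow> ereal" where
  "posterior_expected_loss P \<mu> qf q =
     ereal_integral P (\<lambda>\<eta>. reverse_KL_loss \<mu> (qf (fst \<eta>)) q)"

definition bayes_predictive_density ::
    "('v \<times> 'w) measure \<Rightarrow> 'b measure \<Rightarrow> ('v \<Rightarrow> 'b \<Rightarrow> real) \<Rightarrow> ('b \<Rightarrow> real) \<Rightarrow> bool" where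
  "bayes_predictive_density P \<mu> qf q \<longleftrightarrow>
     prob_density \<mu> q \<and>
     (\<forall>q'. prob_density \<mu> q' \<longrightarrow>
        posterior_expected_loss P \<mu> qf q \<le> posterior_expected_loss P \<mu> qf q')"

end

theory Submission imports Defs begin

text \<open>
  The log-density \<open>log q\<^bsub>\<theta>\<^esub>(y) = log h(y) + \<theta> \<bullet> t(y) - c(\<theta>)\<close> is affine in \<open>\<theta>\<close> and \<open>c(\<theta>)\<close>, and
  reverse Kullback--Leibler loss is affine in the log-density of the true distribution. Averaging
  over the posterior therefore replaces \<open>\<theta> = \<eta>\<^sub>1\<close> by its posterior mean \<open>\<theta>*\<close> and \<open>c(\<eta>\<^sub>1)\<close> by its
  mean: for every density \<open>r\<close>,
  \<open>E \<integral> r log (r / q\<^bsub>\<eta>\<^sub>1\<^esub>) = \<integral> r log (r / q\<^bsub>\<theta>*\<^esub>) + K\<close> with \<open>K = E c(\<eta>\<^sub>1) - c(\<theta>*)\<close>.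
  The constant \<open>K\<close> does not depend on \<open>r\<close>, and the divergence from \<open>q\<^bsub>\<theta>*\<^esub>\<close> is nonnegative and
  vanishes only for \<open>r = q\<^bsub>\<theta>*\<^esub>\<close> almost everywhere. Hence \<open>q\<^bsub>\<theta>*\<^esub>\<close> is the minimizer, and the only
  one as soon as the minimum is finite.

  Integrability is the delicate point, since the loss may be infinite and the logarithm changes
  sign. For densities the integrand \<open>r log (r / q)\<close> can be replaced by the nonnegative
  \<open>r log (r / q) - r + q\<close> without changing the integral (\<open>reverse_KL_loss_eq_bregman\<close>). Tonelli's
  theorem then reduces the displayed identity to a pointwise one in \<open>y\<close>
  (\<open>kl_bregman_compensation\<close>, \<open>expected_loss_identity\<close>), which requires only that \<open>c(\<eta>\<^sub>1)\<close> has a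
  finite mean; otherwise all expected losses are infinite (\<open>finite_loss_imp_integrable\<close>).

  Two further facts make this meaningful. The mean \<open>\<theta>*\<close> is a natural parameter, because the
  natural parameter space is convex and the mean of a distribution on a convex set in finite
  dimension lies in the set, closed or not (\<open>expectation_mem_convex\<close>). And on natural parameters
  the normalizers coincide with the Borel measurable log-partition function
  (\<open>normalizer_eq_log_partition\<close>), so up to null sets all functions of the parameter are measurable.
\<close>

section \<open>The mean of a distribution on a convex set\<close>

text \<open>
  If the mean were outside \<open>S\<close>, a hyperplane through it would have \<open>S\<close> on one side. A nonnegative
  variable with mean zero vanishes, so \<open>X\<close> would lie almost surely in the part of \<open>S\<close> on the
  hyperplane, a convex set of smaller dimension with the same property; this descent ends.
\<close>
theorem (in prob_space) expectation_mem_convex: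
  fixes X :: "'a \<Rightarrow> 'v::euclidean_space"
  assumes X: "integrable M X" and "convex S" and "AE x in M. X x \<in> S"
  shows "(\<integral>x. X x \<partial>M) \<in> S"
proof -
  let ?m = "\<integral>x. X x \<partial>M"
  \<comment> \<open>After centring, the dimension of the linear span can serve as the induction measure.\<close>
  have claim: "0 \<in> T" if "convex T" "AE x in M. X x - ?m \<in> T" for T :: "'v set"
    using that
  proof (induction "dim T" arbitrary: T rule: less_induct)
    case less
    show ?case
    proof (rule ccontr)
      assume "0 \<notin> T"
      \<comment> \<open>A normal vector in the span of \<open>T\<close> makes the section by the hyperplane lose dimension.\<close>
      have "T \<noteq> {}"
        using less.prems(2) AE_False by auto
      then obtain a where a: "a \<in> span T" "a \<noteq> 0" "\<And>x. x \<in> T \<Longrightarrow> 0 \<le> a \<bullet> x"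
        using separating_hyperplane_set_0_inspan[OF less.prems(1) _ \<open>0 \<notin> T\<close>] by blast
      have int: "integrable M (\<lambda>x. a \<bullet> (X x - ?m))"
        using X by auto
      have "(\<integral>x. a \<bullet> (X x - ?m) \<partial>M) = 0"
        using X by (simp add: prob_space)
      moreover have nonneg: "AE x in M. 0 \<le> a \<bullet> (X x - ?m)"
        using less.prems(2) by eventually_elim (rule a(3))
      ultimately have "AE x in M. a \<bullet> (X x - ?m) = 0"
        using integral_nonneg_eq_0_iff_AE[OF int] by simp
      with less.prems(2) have AE: "AE x in M. X x - ?m \<in> T \<inter> {x. a \<bullet> x = 0}"
        by eventually_elim simp
      have "span (T \<inter> {x. a \<bullet> x = 0}) \<subseteq> {x. a \<bullet> x = 0}"
        by (rule span_minimal) (auto simp: subspace_hyperplane)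
      then have "a \<notin> span (T \<inter> {x. a \<bullet> x = 0})"
        using \<open>a \<noteq> 0\<close> by auto
      then have "span (T \<inter> {x. a \<bullet> x = 0}) \<subset> span T"
        using \<open>a \<in> span T\<close> span_mono[of "T \<inter> {x. a \<bullet> x = 0}" T] by blast
      then have "dim (T \<inter> {x. a \<bullet> x = 0}) < dim T"
        by (rule dim_psubset)
      moreover have "convex (T \<inter> {x. a \<bullet> x = 0})"
        by (intro convex_Int less.prems convex_hyperplane)
      ultimately have "0 \<in> T \<inter> {x. a \<bullet> x = 0}"
        using less.hyps AE by blast
      with \<open>0 \<notin> T\<close> show False by blast
    qed
  qed
  have "0 \<in> (\<lambda>x. x - ?m) ` S"
    using assms by (intro claim) (auto elim!: eventually_mono)
  then show ?thesis by auto
qed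

section \<open>Natural parameters and the log-partition function\<close>

text \<open>Convexity of \<^const>\<open>exp\<close>, applied under the integral sign.\<close>
lemma convex_natural_params:
  assumes [measurable]: "h \<in> borel_measurable \<mu>" "t \<in> borel_measurable \<mu>"
    and h: "\<And>y. y \<in> space \<mu> \<Longrightarrow> 0 \<le> h y"
  shows "convex (natural_params \<mu> h (t :: 'a \<Rightarrow> 'v::euclidean_space))"
proof (rule convexI)
  fix a b :: 'v and u v :: real
  assume ab: "a \<in> natural_params \<mu> h t" "b \<in> natural_params \<mu> h t"
    and uv: "0 \<le> u" "0 \<le> v" "u + v = 1"
  have "(\<integral>\<^sup>+y. ennreal (h y * exp ((u *\<^sub>R a + v *\<^sub>R b) \<bullet> t y)) \<partial>\<mu>)
      \<le> (\<integral>\<^sup>+y. ennreal u * ennreal (h y * exp (a \<bullet> t y)) + ennreal v * ennreal (h y * exp (b \<bullet> t y)) \<partial>\<mu>)"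
  proof (rule nn_integral_mono)
    fix y assume y: "y \<in> space \<mu>"
    have "exp (u * (a \<bullet> t y) + v * (b \<bullet> t y)) \<le> u * exp (a \<bullet> t y) + v * exp (b \<bullet> t y)"
    proof -
      have "u = 1 - v" "v \<le> 1" using uv by auto
      then show ?thesis
        using convex_onD[OF exp_convex, of v "a \<bullet> t y" "b \<bullet> t y"] \<open>0 \<le> v\<close> by simp
    qed
    from mult_left_mono[OF this h[OF y]]
    show "ennreal (h y * exp ((u *\<^sub>R a + v *\<^sub>R b) \<bullet> t y))
        \<le> ennreal u * ennreal (h y * exp (a \<bullet> t y)) + ennreal v * ennreal (h y * exp (b \<bullet> t y))"
      using h[OF y] uv
      by (simp add: inner_add_left ennreal_mult[symmetric] ennreal_plus[symmetric] algebra_simps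
          del: ennreal_plus)
  qed
  also have "\<dots> < \<infinity>"
    using ab by (simp add: natural_params_def nn_integral_add nn_integral_cmult
        ennreal_mult_less_top)
  finally show "u *\<^sub>R a + v *\<^sub>R b \<in> natural_params \<mu> h t"
    by (simp add: natural_params_def)
qed

definition log_partition :: "'a measure \<Rightarrow> ('a \<Rightarrow> real) \<Rightarrow> ('a \<Rightarrow> 'v::real_inner) \<Rightarrow> 'v \<Rightarrow> real" where
  "log_partition \<mu> h t \<theta> = ln (enn2real (\<integral>\<^sup>+y. ennreal (h y * exp (\<theta> \<bullet> t y)) \<partial>\<mu>))"

lemma borel_measurable_log_partition:
  fixes t :: "'a \<Rightarrow> 'v::euclidean_space"
  assumes "sigma_finite_measure \<mu>" and [measurable]: "h \<in> borel_measurable \<mu>" "t \<in> borel_measurable \<mu>"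
  shows "log_partition \<mu> h t \<in> borel_measurable borel"
proof -
  interpret sigma_finite_measure \<mu> by fact
  show ?thesis unfolding log_partition_def[abs_def] by measurable
qed

lemma normalizer_eq_log_partition:
  fixes t :: "'a \<Rightarrow> 'v::euclidean_space"
  assumes [measurable]: "h \<in> borel_measurable \<mu>" "t \<in> borel_measurable \<mu>"
    and h: "\<And>y. y \<in> space \<mu> \<Longrightarrow> 0 \<le> h y"
    and d: "prob_density \<mu> (exp_family h t c \<theta>)"
  shows "c \<theta> = log_partition \<mu> h t \<theta>"
proof -
  let ?Z = "\<integral>\<^sup>+y. ennreal (h y * exp (\<theta> \<bullet> t y)) \<partial>\<mu>"
  have "1 = (\<integral>\<^sup>+y. ennreal (exp (- c \<theta>)) * ennreal (h y * exp (\<theta> \<bullet> t y)) \<partial>\<mu>)"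
  proof -
    have "1 = (\<integral>\<^sup>+y. ennreal (exp_family h t c \<theta> y) \<partial>\<mu>)"
      using d by (simp add: prob_density_def)
    also have "\<dots> = (\<integral>\<^sup>+y. ennreal (exp (- c \<theta>)) * ennreal (h y * exp (\<theta> \<bullet> t y)) \<partial>\<mu>)"
      by (rule nn_integral_cong)
        (simp add: exp_family_def ennreal_mult'[symmetric] exp_diff exp_minus divide_inverse ac_simps)
    finally show ?thesis .
  qed
  also have "\<dots> = ennreal (exp (- c \<theta>)) * ?Z"
    by (rule nn_integral_cmult) simp
  finally have eq: "ennreal (exp (- c \<theta>)) * ?Z = 1" by simp
  then have "?Z = ennreal (exp (c \<theta>))"
  proof (cases ?Z)
    case (real z)
    with eq have "exp (- c \<theta>) * z = 1"
      by (simp add: ennreal_mult[symmetric])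
    then have "z = exp (c \<theta>)" by (simp add: exp_minus field_simps)
    with real show ?thesis by simp
  qed (simp add: ennreal_mult_top)
  then show ?thesis by (simp add: log_partition_def)
qed

section \<open>Kullback--Leibler divergence as the integral of a nonnegative function\<close>

text \<open>
  The Bregman divergence of \<open>a \<mapsto> a log a\<close>. The terms \<open>- a + b\<close> make it nonnegative and cancel
  upon integration when \<open>a\<close> and \<open>b\<close> run through probability densities.
\<close>
definition kl_bregman :: "real \<Rightarrow> real \<Rightarrow> ennreal" where
  "kl_bregman a b =
     (if a = 0 then ennreal b else if b = 0 then \<infinity> else ennreal (a * ln (a / b) - a + b))"

lemma measurable_kl_bregman[measurable (raw)]:
  assumes [measurable]: "f \<in> borel_measurable M" "g \<in> borel_measurable M"
  shows "(\<lambda>x. kl_bregman (f x) (g x)) \<in> borel_measurable M"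
  unfolding kl_bregman_def by measurable

lemma kl_bregman_same: "0 \<le> a \<Longrightarrow> kl_bregman a a = 0"
  by (simp add: kl_bregman_def)

lemma bregman_nonneg:
  fixes a b :: real
  assumes "0 < a" "0 < b"
  shows "0 \<le> a * ln (a / b) - a + b"
proof -
  have "ln (b / a) \<le> b / a - 1" using assms by (intro ln_le_minus_one) simp
  from mult_left_mono[OF this, of a] assms show ?thesis
    by (simp add: ln_div algebra_simps)
qed

lemma kl_bregman_eq_0D:
  assumes "0 \<le> a" "0 \<le> b" "kl_bregman a b = 0"
  shows "a = b"
proof (cases "a = 0 \<or> b = 0")
  case True
  then show ?thesis using assms by (auto simp: kl_bregman_def split: if_splits)
next
  case False
  then have pos: "0 < a" "0 < b" using assms by auto
  with assms(3) bregman_nonneg[OF pos] have "a * ln (a / b) - a + b = 0"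
    by (simp add: kl_bregman_def)
  then have "ln (b / a) = b / a - 1"
    using pos by (simp add: ln_div field_simps)
  from ln_eq_minus_one[OF _ this] pos show ?thesis by simp
qed

text \<open>
  With \<open>F = r log (r / q)\<close> one has \<open>F\<^sup>+ + q = kl_bregman r q + r + F\<^sup>-\<close> pointwise, and \<open>F\<^sup>- \<le> q\<close>. So
  the negative part of the loss is always finite, and the loss is the difference of two integrals
  at most one of which is infinite.
\<close>
lemma reverse_KL_loss_eq_bregman:
  assumes q: "prob_density \<mu> q" and r: "prob_density \<mu> r"
  shows "reverse_KL_loss \<mu> q r = enn2ereal (\<integral>\<^sup>+y. kl_bregman (r y) (q y) \<partial>\<mu>)"
proof -
  define F where "F y = (if r y = 0 then 0 else if q y = 0 then \<infinity> else ereal (r y * ln (r y / q y)))" for y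
  have [measurable]: "q \<in> borel_measurable \<mu>" "r \<in> borel_measurable \<mu>"
    using q r by (auto simp: prob_density_def)
  have [measurable]: "F \<in> borel_measurable \<mu>"
    unfolding F_def[abs_def] by measurable
  let ?pos = "\<integral>\<^sup>+y. e2ennreal (F y) \<partial>\<mu>" and ?neg = "\<integral>\<^sup>+y. e2ennreal (- F y) \<partial>\<mu>"
  let ?D = "\<integral>\<^sup>+y. kl_bregman (r y) (q y) \<partial>\<mu>"
  have nonneg: "0 \<le> q y" "0 \<le> r y" if "y \<in> space \<mu>" for y
    using q r that by (auto simp: prob_density_def)
  have pw: "e2ennreal (F y) + ennreal (q y) = kl_bregman (r y) (q y) + ennreal (r y) + e2ennreal (- F y)"
    if "y \<in> space \<mu>" for y
  proof (cases "r y = 0 \<or> q y = 0")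
    case True
    then show ?thesis
      using nonneg[OF that] by (auto simp: F_def kl_bregman_def e2ennreal_neg)
  next
    case False
    with nonneg[OF that] have pos: "0 < r y" "0 < q y" by auto
    let ?f = "r y * ln (r y / q y)"
    have "ennreal ?f + ennreal (q y) = ennreal (?f - r y + q y) + ennreal (r y) + ennreal (- ?f)"
    proof (cases "0 \<le> ?f")
      case True
      with pos bregman_nonneg[OF pos] show ?thesis
        by (simp add: ennreal_neg ennreal_plus[symmetric] del: ennreal_plus)
    next
      case False
      with pos bregman_nonneg[OF pos] show ?thesis
        by (simp add: ennreal_neg ennreal_plus[symmetric] del: ennreal_plus)
    qed
    with pos show ?thesis by (simp add: F_def kl_bregman_def)
  qed
  have "e2ennreal (- F y) \<le> ennreal (q y)" if "y \<in> space \<mu>" for y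
  proof (cases "r y = 0 \<or> q y = 0")
    case True
    then show ?thesis by (auto simp: F_def e2ennreal_neg)
  next
    case False
    with nonneg[OF that] have pos: "0 < r y" "0 < q y" by auto
    from bregman_nonneg[OF pos] have "- (r y * ln (r y / q y)) \<le> q y" using pos by simp
    with False show ?thesis by (simp add: F_def ennreal_leI)
  qed
  then have "?neg \<le> (\<integral>\<^sup>+y. ennreal (q y) \<partial>\<mu>)"
    by (rule nn_integral_mono)
  then have neg: "?neg \<noteq> \<infinity>"
    using q by (auto simp: prob_density_def top_unique)
  have "(\<integral>\<^sup>+y. e2ennreal (F y) + ennreal (q y) \<partial>\<mu>) =
      (\<integral>\<^sup>+y. kl_bregman (r y) (q y) + ennreal (r y) + e2ennreal (- F y) \<partial>\<mu>)"
    by (rule nn_integral_cong) (rule pw)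
  then have "?pos + 1 = ?D + 1 + ?neg"
    using q r by (simp add: nn_integral_add prob_density_def)
  then have "1 + ?pos = 1 + (?D + ?neg)" by (simp add: ac_simps)
  then have "?pos = ?D + ?neg" by (simp only: ennreal_add_left_cancel) simp
  then have "enn2ereal ?pos - enn2ereal ?neg = enn2ereal ?D"
    using neg by (cases ?neg; cases ?D) (auto simp: plus_ennreal.rep_eq ennreal.rep_eq enn2ereal_ennreal)
  then show ?thesis
    by (simp add: reverse_KL_loss_def ereal_integral_def F_def)
qed

section \<open>Compensation identity\<close>

text \<open>
  Let \<open>e\<^sup>L\<close> be a random positive number whose geometric mean \<open>exp (E L)\<close> is \<open>b e\<^sup>-\<^sup>K\<close>. Since
  \<open>log (a / e\<^sup>L)\<close> is affine in \<open>L\<close>, averaging \<^const>\<open>kl_bregman\<close> in its second argument amounts to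
  evaluating it at \<open>b\<close>, up to the explicit terms \<open>a K\<close>, \<open>E e\<^sup>L\<close> and \<open>b\<close>; this is where averaging
  log-densities, hence natural parameters, comes from. All negative terms are moved to the other
  side, so that the identity lives in \<^typ>\<open>ennreal\<close> and can be integrated term by term. In particular \<open>a K\<close> is split into its positive and negative parts,
  because \<^const>\<open>ennreal\<close> sends negative reals to \<open>0\<close>.
\<close>
lemma (in prob_space) kl_bregman_compensation:
  fixes L :: "'a \<Rightarrow> real"
  assumes a: "0 \<le> a" and b: "0 < b" and L: "integrable M L" and mean: "(\<integral>x. L x \<partial>M) = ln b - K"
    and fin: "(\<integral>\<^sup>+x. ennreal (exp (L x)) \<partial>M) < \<infinity>"
  shows "(\<integral>\<^sup>+x. kl_bregman a (exp (L x)) \<partial>M) + ennreal b + ennreal a * ennreal (- K) =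
    kl_bregman a b + ennreal a * ennreal K + (\<integral>\<^sup>+x. ennreal (exp (L x)) \<partial>M)"
proof (cases "a = 0")
  case True
  then show ?thesis by (simp add: kl_bregman_def add.commute)
next
  case False
  with a have "0 < a" by simp
  have [measurable]: "L \<in> borel_measurable M" using L by auto
  have expL: "integrable M (\<lambda>x. exp (L x))"
    using fin by (intro integrableI_bounded) auto
  let ?m = "\<integral>x. exp (L x) \<partial>M"
  let ?v = "a * ln a - a * (ln b - K) - a + ?m" and ?w = "a * ln (a / b) - a + b"
  have form: "a * ln (a / exp (L x)) - a + exp (L x) = a * ln a - a * L x - a + exp (L x)" for x
    using \<open>0 < a\<close> by (simp add: ln_div algebra_simps)
  have nonneg: "0 \<le> a * ln a - a * L x - a + exp (L x)" for x
    using bregman_nonneg[OF \<open>0 < a\<close>, of "exp (L x)"] form[of x] by simp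
  have int: "integrable M (\<lambda>x. a * ln a - a * L x - a + exp (L x))"
    using L expL by auto
  have "(\<integral>\<^sup>+x. kl_bregman a (exp (L x)) \<partial>M) = (\<integral>\<^sup>+x. ennreal (a * ln a - a * L x - a + exp (L x)) \<partial>M)"
    using False by (simp add: kl_bregman_def form)
  also have "\<dots> = ennreal (\<integral>x. a * ln a - a * L x - a + exp (L x) \<partial>M)"
    using int nonneg by (intro nn_integral_eq_integral) auto
  also have "(\<integral>x. a * ln a - a * L x - a + exp (L x) \<partial>M) = ?v"
    using L expL mean by (simp add: prob_space)
  finally have 1: "(\<integral>\<^sup>+x. kl_bregman a (exp (L x)) \<partial>M) = ennreal ?v" .
  have 2: "(\<integral>\<^sup>+x. ennreal (exp (L x)) \<partial>M) = ennreal ?m"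
    using expL by (intro nn_integral_eq_integral) auto
  have "0 \<le> (\<integral>x. a * ln a - a * L x - a + exp (L x) \<partial>M)"
    using nonneg by (intro integral_nonneg_AE) auto
  then have v: "0 \<le> ?v" using L expL mean by (simp add: prob_space)
  have w: "0 \<le> ?w" by (rule bregman_nonneg) fact+
  have m: "0 \<le> ?m" by (intro integral_nonneg_AE) auto
  have eq: "?v = ?w + a * K + ?m - b"
    using \<open>0 < a\<close> b by (simp add: ln_div algebra_simps)
  have "ennreal ?v + ennreal b + ennreal a * ennreal (- K) = ennreal ?w + ennreal a * ennreal K + ennreal ?m"
  proof (cases "0 \<le> K")
    case True
    then have "ennreal ?v + ennreal b = ennreal (?v + b)"
      using v b by simp
    also have "?v + b = ?w + a * K + ?m" using eq by simp
    also have "ennreal \<dots> = ennreal ?w + ennreal a * ennreal K + ennreal ?m"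
      using True \<open>0 < a\<close> w m by (simp add: ennreal_mult del: mult_pos_pos)
    finally show ?thesis using True by (simp add: ennreal_neg)
  next
    case False
    then have "0 \<le> - K" by simp
    then have "ennreal a * ennreal (- K) = ennreal (a * (- K))"
      using \<open>0 < a\<close> by (intro ennreal_mult[symmetric]) auto
    moreover have "0 \<le> a * (- K)"
      using \<open>0 < a\<close> \<open>0 \<le> - K\<close> by (intro mult_nonneg_nonneg) auto
    ultimately have "ennreal ?v + ennreal b + ennreal a * ennreal (- K) = ennreal (?v + b + a * (- K))"
      using v b by (simp only: ennreal_plus[symmetric] add_nonneg_nonneg less_imp_le)
    also have "?v + b + a * (- K) = ?w + ?m" using eq by (simp add: algebra_simps)
    also have "ennreal \<dots> = ennreal ?w + ennreal ?m"
      using w m by simp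
    finally show ?thesis using False by (simp add: ennreal_neg)
  qed
  with 1 2 False \<open>0 < b\<close> show ?thesis by (simp add: kl_bregman_def)
qed

section \<open>Posterior distributions on an exponential family\<close>

text \<open>
  \<open>P\<close> plays the part of the posterior distribution of \<open>\<eta> = (\<eta>\<^sub>1, \<eta>\<^sub>2)\<close>. The log-normalizer is Borel on the whole space so that the density is jointly measurable in
  parameter and observation, as Tonelli's theorem needs.
\<close>
locale exp_family_posterior = prob_space P + Y: sigma_finite_measure \<mu>
  for P :: "('v::euclidean_space \<times> 'w) measure" and \<mu> :: "'b measure" +
  fixes h :: "'b \<Rightarrow> real" and t :: "'b \<Rightarrow> 'v" and c :: "'v \<Rightarrow> real"
  assumes h_measurable[measurable]: "h \<in> borel_measurable \<mu>"
    and h_nonneg: "\<And>y. y \<in> space \<mu> \<Longrightarrow> 0 \<le> h y"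
    and t_measurable[measurable]: "t \<in> borel_measurable \<mu>"
    and c_measurable[measurable]: "c \<in> borel_measurable borel"
    and normalized: "\<And>\<theta>. \<theta> \<in> natural_params \<mu> h t \<Longrightarrow> prob_density \<mu> (exp_family h t c \<theta>)"
    and AE_natural: "AE \<eta> in P. fst \<eta> \<in> natural_params \<mu> h t"
    and integrable_parameter: "integrable P fst"
begin

abbreviation "q \<equiv> exp_family h t c"

definition post_mean :: 'v where
  "post_mean = (\<integral>\<eta>. fst \<eta> \<partial>P)"

text \<open>The posterior predictive density, which is Bayes for the non-reversed Kullback--Leibler loss.
  It comes in as the mean of the last term of \<^const>\<open>kl_bregman\<close> and cancels out again because it
  has total mass one.\<close>
definition mixture :: "'b \<Rightarrow> ennreal" where
  "mixture y = (\<integral>\<^sup>+\<eta>. ennreal (q (fst \<eta>) y) \<partial>P)"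

text \<open>The Jensen gap of the log-partition function under the posterior, which is the minimal
  expected loss whenever that is finite.\<close>
definition log_partition_gap :: real where
  "log_partition_gap = (\<integral>\<eta>. c (fst \<eta>) \<partial>P) - c post_mean"

sublocale pair_sigma_finite P \<mu> ..

lemma fst_measurable_P[measurable]: "fst \<in> borel_measurable P"
  using integrable_parameter by auto

lemma q_measurable[measurable (raw)]:
  assumes f[measurable]: "f \<in> measurable N P" and g[measurable]: "g \<in> measurable N \<mu>"
  shows "(\<lambda>z. q (fst (f z)) (g z)) \<in> borel_measurable N"
proof -
  have [measurable]: "(\<lambda>z. fst (f z)) \<in> borel_measurable N"
    by (rule measurable_compose[OF f fst_measurable_P])
  have [measurable]: "(\<lambda>z. c (fst (f z))) \<in> borel_measurable N"
    by (rule measurable_compose[OF _ c_measurable]) measurable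
  show ?thesis unfolding exp_family_def by measurable
qed

lemma post_mean_natural: "post_mean \<in> natural_params \<mu> h t"
  unfolding post_mean_def
  by (intro expectation_mem_convex integrable_parameter AE_natural convex_natural_params
      h_measurable t_measurable h_nonneg)

lemma prob_density_post_mean: "prob_density \<mu> (q post_mean)"
  by (intro normalized post_mean_natural)

lemma q_post_mean_measurable[measurable]: "q post_mean \<in> borel_measurable \<mu>"
  using prob_density_post_mean by (simp add: prob_density_def)

lemma mixture_measurable[measurable]: "mixture \<in> borel_measurable \<mu>"
  unfolding mixture_def[abs_def] by measurable

lemma AE_prob_density: "AE \<eta> in P. prob_density \<mu> (q (fst \<eta>))"
  using AE_natural by eventually_elim (rule normalized)

lemma nn_integral_mixture: "(\<integral>\<^sup>+y. mixture y \<partial>\<mu>) = 1"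
proof -
  have "(\<integral>\<^sup>+y. mixture y \<partial>\<mu>) = (\<integral>\<^sup>+\<eta>. (\<integral>\<^sup>+y. ennreal (q (fst \<eta>) y) \<partial>\<mu>) \<partial>P)"
    unfolding mixture_def by (rule Fubini') measurable
  also have "\<dots> = (\<integral>\<^sup>+\<eta>. 1 \<partial>P)"
    by (intro nn_integral_cong_AE) (use AE_prob_density in \<open>eventually_elim, simp add: prob_density_def\<close>)
  finally show ?thesis by (simp add: emeasure_space_1)
qed

lemma AE_mixture_finite: "AE y in \<mu>. mixture y < \<infinity>"
  using nn_integral_PInf_AE[of mixture \<mu>] nn_integral_mixture by (simp add: less_top)

definition pointwise_loss :: "('b \<Rightarrow> real) \<Rightarrow> 'b \<Rightarrow> ennreal" where
  "pointwise_loss r y = (\<integral>\<^sup>+\<eta>. kl_bregman (r y) (q (fst \<eta>) y) \<partial>P)"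

lemma pointwise_loss_measurable[measurable]:
  assumes [measurable]: "r \<in> borel_measurable \<mu>"
  shows "pointwise_loss r \<in> borel_measurable \<mu>"
  unfolding pointwise_loss_def[abs_def] by measurable

text \<open>
  Because the integrand is nonnegative, the two integrations can be exchanged even when the
  expected loss is infinite.
\<close>
lemma posterior_expected_loss_eq:
  assumes r: "prob_density \<mu> r"
  shows "posterior_expected_loss P \<mu> q r = enn2ereal (\<integral>\<^sup>+y. pointwise_loss r y \<partial>\<mu>)"
proof -
  have [measurable]: "r \<in> borel_measurable \<mu>" using r by (simp add: prob_density_def)
  let ?G = "\<lambda>\<eta>. \<integral>\<^sup>+y. kl_bregman (r y) (q (fst \<eta>) y) \<partial>\<mu>"
  have AE: "AE \<eta> in P. reverse_KL_loss \<mu> (q (fst \<eta>)) r = enn2ereal (?G \<eta>)"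
    using AE_prob_density by eventually_elim (rule reverse_KL_loss_eq_bregman[OF _ r])
  have "(\<integral>\<^sup>+\<eta>. e2ennreal (reverse_KL_loss \<mu> (q (fst \<eta>)) r) \<partial>P) = (\<integral>\<^sup>+\<eta>. ?G \<eta> \<partial>P)"
    by (intro nn_integral_cong_AE) (use AE in \<open>eventually_elim, simp\<close>)
  moreover have "(\<integral>\<^sup>+\<eta>. e2ennreal (- reverse_KL_loss \<mu> (q (fst \<eta>)) r) \<partial>P) = (\<integral>\<^sup>+\<eta>. 0 \<partial>P)"
    by (intro nn_integral_cong_AE) (use AE in \<open>eventually_elim, simp add: e2ennreal_neg\<close>)
  moreover have "(\<integral>\<^sup>+\<eta>. ?G \<eta> \<partial>P) = (\<integral>\<^sup>+y. pointwise_loss r y \<partial>\<mu>)"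
    unfolding pointwise_loss_def by (rule Fubini'[symmetric]) measurable
  ultimately show ?thesis
    by (simp add: posterior_expected_loss_def ereal_integral_def zero_ennreal.rep_eq)
qed

lemma log_q: "0 < h y \<Longrightarrow> q \<theta> y = exp (ln (h y) + (\<theta> \<bullet> t y - c \<theta>))"
  by (simp add: exp_family_def exp_add)

text \<open>
  The compensation identity with \<open>L = log q\<^bsub>\<eta>\<^sub>1\<^esub>(y)\<close>, which is affine in \<open>\<eta>\<^sub>1\<close> and \<open>c(\<eta>\<^sub>1)\<close>: its
  mean is the log-density at the posterior mean, up to the constant \<^const>\<open>log_partition_gap\<close>,
  which does not depend on \<open>y\<close>. Off the support of \<open>h\<close> both sides are \<open>0\<close> or both are \<open>\<infinity>\<close>.
\<close>
lemma pointwise_loss_identity: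
  assumes c: "integrable P (\<lambda>\<eta>. c (fst \<eta>))" and y: "y \<in> space \<mu>" "mixture y < \<infinity>" and r: "0 \<le> r y"
  shows "pointwise_loss r y + ennreal (q post_mean y) + ennreal (r y) * ennreal (- log_partition_gap) =
    kl_bregman (r y) (q post_mean y) + ennreal (r y) * ennreal log_partition_gap + mixture y"
proof (cases "h y = 0")
  case True
  then show ?thesis using emeasure_space_1
    by (cases "r y = 0") (simp_all add: pointwise_loss_def mixture_def exp_family_def kl_bregman_def)
next
  case False
  with h_nonneg[OF y(1)] have "0 < h y" by simp
  let ?L = "\<lambda>\<eta>. ln (h y) + (fst \<eta> \<bullet> t y - c (fst \<eta>))"
  have "(\<integral>\<eta>. ?L \<eta> \<partial>P) = ln (h y) + (post_mean \<bullet> t y - (\<integral>\<eta>. c (fst \<eta>) \<partial>P))"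
    using c integrable_parameter by (simp add: prob_space post_mean_def)
  also have "\<dots> = ln (q post_mean y) - log_partition_gap"
    by (simp add: log_q[OF \<open>0 < h y\<close>] log_partition_gap_def)
  finally have "(\<integral>\<eta>. ?L \<eta> \<partial>P) = ln (q post_mean y) - log_partition_gap" .
  moreover have "integrable P ?L"
    using c integrable_parameter by auto
  moreover have "0 < q post_mean y"
    using \<open>0 < h y\<close> by (simp add: exp_family_def)
  ultimately show ?thesis
    using kl_bregman_compensation[of "r y" "q post_mean y" ?L log_partition_gap] r y(2)
    by (simp add: pointwise_loss_def mixture_def log_q[OF \<open>0 < h y\<close>])
qed

text \<open>
  Expected loss = divergence from the plug-in density + a constant that is independent of \<open>r\<close>.
  All densities in the pointwise identity integrate to one, which turns the correction terms into
  the constant.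
\<close>
lemma expected_loss_identity:
  assumes c: "integrable P (\<lambda>\<eta>. c (fst \<eta>))" and r: "prob_density \<mu> r"
  shows "(\<integral>\<^sup>+y. pointwise_loss r y \<partial>\<mu>) + ennreal (- log_partition_gap) =
    (\<integral>\<^sup>+y. kl_bregman (r y) (q post_mean y) \<partial>\<mu>) + ennreal log_partition_gap"
proof -
  let ?D = "\<integral>\<^sup>+y. kl_bregman (r y) (q post_mean y) \<partial>\<mu>" and ?R = "\<integral>\<^sup>+y. pointwise_loss r y \<partial>\<mu>"
  have [measurable]: "r \<in> borel_measurable \<mu>" using r by (simp add: prob_density_def)
  have "(\<integral>\<^sup>+y. pointwise_loss r y + ennreal (q post_mean y) + ennreal (r y) * ennreal (- log_partition_gap) \<partial>\<mu>) =
    (\<integral>\<^sup>+y. kl_bregman (r y) (q post_mean y) + ennreal (r y) * ennreal log_partition_gap + mixture y \<partial>\<mu>)"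
  proof (rule nn_integral_cong_AE, use AE_mixture_finite AE_space in eventually_elim)
    fix y assume "mixture y < \<infinity>" "y \<in> space \<mu>"
    then show "pointwise_loss r y + ennreal (q post_mean y) + ennreal (r y) * ennreal (- log_partition_gap) =
      kl_bregman (r y) (q post_mean y) + ennreal (r y) * ennreal log_partition_gap + mixture y"
      using pointwise_loss_identity[OF c] r by (simp add: prob_density_def)
  qed
  then have "?R + 1 + ennreal (- log_partition_gap) = ?D + ennreal log_partition_gap + 1"
    using r prob_density_post_mean nn_integral_mixture
    by (simp add: nn_integral_add nn_integral_multc prob_density_def)
  then have "1 + (?R + ennreal (- log_partition_gap)) = 1 + (?D + ennreal log_partition_gap)"
    by (simp add: ac_simps)
  then show ?thesis by (simp only: ennreal_add_left_cancel) simp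
qed

text \<open>
  If some density has finite expected loss, then at almost every \<open>y\<close> where it is positive the
  function \<open>\<eta> \<mapsto> r(y) log (r(y) / q\<^bsub>\<eta>\<^sub>1\<^esub>(y))\<close> is integrable. At a single such \<open>y\<close> one solves for
  \<open>c(\<eta>\<^sub>1)\<close>, all other terms being integrable. So if \<open>c(\<eta>\<^sub>1)\<close> has no finite mean, every density
  has infinite expected loss.
\<close>
lemma finite_loss_imp_integrable:
  assumes r: "prob_density \<mu> r" and fin: "(\<integral>\<^sup>+y. pointwise_loss r y \<partial>\<mu>) < \<infinity>"
  shows "integrable P (\<lambda>\<eta>. c (fst \<eta>))"
proof -
  have [measurable]: "r \<in> borel_measurable \<mu>" using r by (simp add: prob_density_def)
  have "AE y in \<mu>. pointwise_loss r y < \<infinity>"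
    using nn_integral_PInf_AE[of "pointwise_loss r" \<mu>] fin by (simp add: less_top)
  with AE_mixture_finite AE_space have AE: "AE y in \<mu>. y \<in> space \<mu> \<and> mixture y < \<infinity> \<and> pointwise_loss r y < \<infinity>"
    by eventually_elim simp
  obtain y where y: "y \<in> space \<mu>" "mixture y < \<infinity>" "pointwise_loss r y < \<infinity>" "r y \<noteq> 0"
  proof (rule ccontr)
    assume "\<not> thesis"
    with that have zero: "\<And>y. y \<in> space \<mu> \<and> mixture y < \<infinity> \<and> pointwise_loss r y < \<infinity> \<Longrightarrow> r y = 0"
      by blast
    from AE have "AE y in \<mu>. ennreal (r y) = 0"
      by (rule eventually_mono) (simp add: zero)
    then have "(\<integral>\<^sup>+y. ennreal (r y) \<partial>\<mu>) = 0"
      by (simp add: nn_integral_0_iff_AE)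
    with r show False by (simp add: prob_density_def)
  qed
  with r have a: "0 < r y" by (auto simp: prob_density_def less_le)
  have "h y \<noteq> 0"
    using y emeasure_space_1 by (auto simp: pointwise_loss_def kl_bregman_def exp_family_def)
  with h_nonneg y have "0 < h y" by (simp add: less_le)
  let ?L = "\<lambda>\<eta>. ln (h y) + (fst \<eta> \<bullet> t y - c (fst \<eta>))"
  let ?B = "\<lambda>\<eta>. r y * ln (r y / exp (?L \<eta>)) - r y + exp (?L \<eta>)"
  have "integrable P ?B"
    using y(3) \<open>r y \<noteq> 0\<close> bregman_nonneg[OF a]
    by (intro integrableI_bounded)
      (auto simp: pointwise_loss_def kl_bregman_def log_q[OF \<open>0 < h y\<close>])
  moreover have "integrable P (\<lambda>\<eta>. exp (?L \<eta>))"
    using y(2) by (intro integrableI_bounded) (auto simp: mixture_def log_q[OF \<open>0 < h y\<close>])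
  ultimately have "integrable P (\<lambda>\<eta>. ?B \<eta> - exp (?L \<eta>))"
    by (rule Bochner_Integration.integrable_diff)
  then have "integrable P (\<lambda>\<eta>. (?B \<eta> - exp (?L \<eta>) + r y) / r y - ln (r y) + ln (h y) + fst \<eta> \<bullet> t y)"
    by (intro Bochner_Integration.integrable_add[OF Bochner_Integration.integrable_add]
        Bochner_Integration.integrable_diff[OF integrable_divide integrable_const]
        Bochner_Integration.integrable_add[OF _ integrable_const]
        integrable_const integrable_inner_left integrable_parameter)
  also have "(\<lambda>\<eta>. (?B \<eta> - exp (?L \<eta>) + r y) / r y - ln (r y) + ln (h y) + fst \<eta> \<bullet> t y) = (\<lambda>\<eta>. c (fst \<eta>))"
    using a by (auto simp: ln_div)
  finally show ?thesis .
qed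

lemma divergence_self: "(\<integral>\<^sup>+y. kl_bregman (q post_mean y) (q post_mean y) \<partial>\<mu>) = 0"
  using prob_density_post_mean
  by (subst nn_integral_0_iff_AE) (auto simp: kl_bregman_same prob_density_def)

lemma bayes_post_mean: "bayes_predictive_density P \<mu> q (q post_mean)"
  unfolding bayes_predictive_density_def
proof (intro conjI allI impI prob_density_post_mean)
  fix r assume r: "prob_density \<mu> r"
  let ?R = "\<lambda>r. \<integral>\<^sup>+y. pointwise_loss r y \<partial>\<mu>"
  have "?R (q post_mean) \<le> ?R r"
  proof (cases "?R r < \<infinity>")
    case True
    then have c: "integrable P (\<lambda>\<eta>. c (fst \<eta>))"
      by (rule finite_loss_imp_integrable[OF r])
    have "ennreal (- log_partition_gap) + ?R (q post_mean) \<le> ennreal (- log_partition_gap) + ?R r"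
      using expected_loss_identity[OF c r] expected_loss_identity[OF c prob_density_post_mean]
      by (simp add: divergence_self add.commute)
    then show ?thesis by (simp only: ennreal_add_left_cancel_le) simp
  next
    case False
    then show ?thesis by (simp add: not_less top_unique)
  qed
  then show "posterior_expected_loss P \<mu> q (q post_mean) \<le> posterior_expected_loss P \<mu> q r"
    by (simp add: posterior_expected_loss_eq r prob_density_post_mean less_eq_ennreal.rep_eq)
qed

lemma bayes_unique:
  assumes r0: "prob_density \<mu> r0" "posterior_expected_loss P \<mu> q r0 < \<infinity>"
    and r: "bayes_predictive_density P \<mu> q r"
  shows "AE y in \<mu>. r y = q post_mean y"
proof -
  let ?R = "\<lambda>r. \<integral>\<^sup>+y. pointwise_loss r y \<partial>\<mu>" and ?K = log_partition_gap
  let ?D = "\<integral>\<^sup>+y. kl_bregman (r y) (q post_mean y) \<partial>\<mu>"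
  have rd: "prob_density \<mu> r" using r by (simp add: bayes_predictive_density_def)
  have [measurable]: "r \<in> borel_measurable \<mu>" using rd by (simp add: prob_density_def)
  have "?R r0 < \<infinity>"
    using r0 by (simp add: posterior_expected_loss_eq less_ennreal.rep_eq)
  then have c: "integrable P (\<lambda>\<eta>. c (fst \<eta>))"
    by (rule finite_loss_imp_integrable[OF r0(1)])
  have "?R r \<le> ?R (q post_mean)"
    using r prob_density_post_mean
    by (auto simp: bayes_predictive_density_def posterior_expected_loss_eq less_eq_ennreal.rep_eq)
  then have "ennreal ?K + ?D \<le> ennreal ?K + 0"
    using expected_loss_identity[OF c rd] expected_loss_identity[OF c prob_density_post_mean]
    by (metis add.commute add_left_mono divergence_self)
  then have "?D \<le> 0" by (simp only: ennreal_add_left_cancel_le) simp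
  then have "AE y in \<mu>. kl_bregman (r y) (q post_mean y) = 0"
    by (simp add: nn_integral_0_iff_AE)
  with AE_space show ?thesis
    by eventually_elim
      (use rd prob_density_post_mean in \<open>auto simp: prob_density_def intro: kl_bregman_eq_0D\<close>)
qed

end

section \<open>The posterior distribution\<close>

text \<open>
  The likelihood \<open>\<eta> \<mapsto> p\<^bsub>\<eta>\<^esub>(x)\<close> is known to be measurable only up to a null set, because the
  normalizer is arbitrary outside the natural parameters. The set function defining
  \<^const>\<open>density\<close> does not see null sets, so this function can be replaced by a measurable one.
\<close>
lemma density_cong_AE:
  assumes "AE x in M. f x = g x"
  shows "density M f = density M g"
proof -
  have "(\<lambda>A. \<integral>\<^sup>+x. f x * indicator A x \<partial>M) = (\<lambda>A. \<integral>\<^sup>+x. g x * indicator A x \<partial>M)"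
    by (intro ext nn_integral_cong_AE) (use assms in \<open>eventually_elim, simp\<close>)
  then show ?thesis by (simp add: density_def)
qed

lemma prob_space_posterior:
  assumes g[measurable]: "g \<in> borel_measurable \<pi>" and ae: "AE \<eta> in \<pi>. p \<eta> x = g \<eta>"
    and marginal: "0 < marginal \<pi> p x" "marginal \<pi> p x < \<infinity>"
  shows "prob_space (posterior \<pi> p x)"
    and "(AE \<eta> in \<pi>. Q \<eta>) \<Longrightarrow> (AE \<eta> in posterior \<pi> p x. Q \<eta>)"
proof -
  let ?m = "marginal \<pi> p x"
  have eq: "posterior \<pi> p x = density \<pi> (\<lambda>\<eta>. ennreal (g \<eta>) / ?m)"
    unfolding posterior_def by (rule density_cong_AE) (use ae in \<open>eventually_elim, simp\<close>)
  have m: "?m = (\<integral>\<^sup>+\<eta>. ennreal (g \<eta>) \<partial>\<pi>)"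
    unfolding marginal_def by (rule nn_integral_cong_AE) (use ae in \<open>eventually_elim, simp\<close>)
  show "prob_space (posterior \<pi> p x)"
  proof
    have "emeasure (posterior \<pi> p x) (space (posterior \<pi> p x)) = (\<integral>\<^sup>+\<eta>. ennreal (g \<eta>) / ?m \<partial>\<pi>)"
      by (simp add: eq emeasure_density cong: nn_integral_cong)
    also have "\<dots> = ?m / ?m" by (simp add: nn_integral_divide m)
    also have "\<dots> = 1" using marginal by (intro ennreal_divide_self) auto
    finally show "emeasure (posterior \<pi> p x) (space (posterior \<pi> p x)) = 1" .
  qed
  show "AE \<eta> in posterior \<pi> p x. Q \<eta>" if "AE \<eta> in \<pi>. Q \<eta>"
    unfolding eq by (subst AE_density) (use that in auto)
qed

lemma posterior_expected_loss_cong: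
  assumes "AE \<eta> in P. q (fst \<eta>) = q' (fst \<eta>)"
  shows "posterior_expected_loss P \<mu> q r = posterior_expected_loss P \<mu> q' r"
proof -
  have 1: "(\<integral>\<^sup>+\<eta>. e2ennreal (reverse_KL_loss \<mu> (q (fst \<eta>)) r) \<partial>P) =
      (\<integral>\<^sup>+\<eta>. e2ennreal (reverse_KL_loss \<mu> (q' (fst \<eta>)) r) \<partial>P)"
    by (rule nn_integral_cong_AE) (use assms in \<open>eventually_elim, simp\<close>)
  have 2: "(\<integral>\<^sup>+\<eta>. e2ennreal (- reverse_KL_loss \<mu> (q (fst \<eta>)) r) \<partial>P) =
      (\<integral>\<^sup>+\<eta>. e2ennreal (- reverse_KL_loss \<mu> (q' (fst \<eta>)) r) \<partial>P)"
    by (rule nn_integral_cong_AE) (use assms in \<open>eventually_elim, simp\<close>)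
  show ?thesis
    unfolding posterior_expected_loss_def ereal_integral_def 1 2 ..
qed

theorem theorem6p1:
  fixes \<mu>1 :: "'x measure" and \<mu>2 :: "'y measure"
    and h1 :: "'x \<Rightarrow> real" and s1 s2 :: "'x \<Rightarrow> real ^ 'p"
    and c1 :: "(real ^ 'p) \<times> (real ^ 'p) \<Rightarrow> real"
    and h2 :: "'y \<Rightarrow> real" and t1 :: "'y \<Rightarrow> real ^ 'p" and c2 :: "real ^ 'p \<Rightarrow> real"
    and \<pi> :: "((real ^ 'p) \<times> (real ^ 'p)) measure" and x :: 'x
    and p :: "(real ^ 'p) \<times> (real ^ 'p) \<Rightarrow> 'x \<Rightarrow> real" and q :: "real ^ 'p \<Rightarrow> 'y \<Rightarrow> real"
    and post :: "((real ^ 'p) \<times> (real ^ 'p)) measure" and \<eta>1_hat :: "real ^ 'p"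
  assumes sigma_finite: "sigma_finite_measure \<mu>1" "sigma_finite_measure \<mu>2"
    and h1: "h1 \<in> borel_measurable \<mu>1" "\<And>u. u \<in> space \<mu>1 \<Longrightarrow> 0 \<le> h1 u"
    and s: "s1 \<in> borel_measurable \<mu>1" "s2 \<in> borel_measurable \<mu>1"
    and h2: "h2 \<in> borel_measurable \<mu>2" "\<And>y. y \<in> space \<mu>2 \<Longrightarrow> 0 \<le> h2 y"
    and t1: "t1 \<in> borel_measurable \<mu>2"
    and p_def: "p = exp_family h1 (\<lambda>u. (s1 u, s2 u)) c1"
    and q_def: "q = exp_family h2 t1 c2"
    and p_density: "\<And>\<eta>. \<eta> \<in> natural_params \<mu>1 h1 (\<lambda>u. (s1 u, s2 u)) \<Longrightarrow> prob_density \<mu>1 (p \<eta>)"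
    and q_density: "\<And>\<eta>1. \<eta>1 \<in> natural_params \<mu>2 h2 t1 \<Longrightarrow> prob_density \<mu>2 (q \<eta>1)"
    and prior: "sets \<pi> = sets borel"
      "AE \<eta> in \<pi>. \<eta> \<in> natural_params \<mu>1 h1 (\<lambda>u. (s1 u, s2 u)) \<and> fst \<eta> \<in> natural_params \<mu>2 h2 t1"
    and x: "x \<in> space \<mu>1"
    and posterior_exists: "0 < marginal \<pi> p x" "marginal \<pi> p x < \<infinity>"
    and post_def: "post = posterior \<pi> p x"
    and expectation_exists: "integrable post fst"
    and \<eta>1_hat_def: "\<eta>1_hat = (\<integral>\<eta>. fst \<eta> \<partial>post)"
  shows "bayes_predictive_density post \<mu>2 q (q \<eta>1_hat) \<and>
    ((\<exists>r. prob_density \<mu>2 r \<and> posterior_expected_loss post \<mu>2 q r < \<infinity>) \<longrightarrow>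
       (\<forall>r. bayes_predictive_density post \<mu>2 q r \<longrightarrow> (AE y in \<mu>2. r y = q \<eta>1_hat y)))"
proof -
  define N2 where "N2 = natural_params \<mu>2 h2 t1"
  \<comment> \<open>Borel measurable versions of the normalizers, equal to them at all natural parameters\<close>
  define c1' where "c1' = log_partition \<mu>1 h1 (\<lambda>u. (s1 u, s2 u))"
  define c2' where "c2' = log_partition \<mu>2 h2 t1"
  define q' where "q' = exp_family h2 t1 c2'"
  have s12: "(\<lambda>u. (s1 u, s2 u)) \<in> borel_measurable \<mu>1"
    by (intro borel_measurable_Pair s)
  have c1_eq: "c1 \<eta> = c1' \<eta>" if "\<eta> \<in> natural_params \<mu>1 h1 (\<lambda>u. (s1 u, s2 u))" for \<eta>
    unfolding c1'_def
    by (rule normalizer_eq_log_partition[OF h1(1) s12 h1(2)])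
      (use p_density that p_def in auto)
  have p_eq: "AE \<eta> in \<pi>. p \<eta> x = exp_family h1 (\<lambda>u. (s1 u, s2 u)) c1' \<eta> x"
    using prior(2) by eventually_elim (simp add: c1_eq p_def exp_family_def)
  have q_eq: "q \<theta> = q' \<theta>" if "\<theta> \<in> N2" for \<theta>
  proof -
    have "c2 \<theta> = c2' \<theta>"
      unfolding c2'_def
      by (rule normalizer_eq_log_partition[OF h2(1) t1 h2(2)])
        (use q_density that q_def N2_def in auto)
    then show ?thesis by (simp add: q_def q'_def exp_family_def fun_eq_iff)
  qed
  have [measurable]: "c1' \<in> borel_measurable borel"
    unfolding c1'_def by (rule borel_measurable_log_partition[OF sigma_finite(1) h1(1) s12])
  have "(\<lambda>\<eta>. exp_family h1 (\<lambda>u. (s1 u, s2 u)) c1' \<eta> x) \<in> borel_measurable \<pi>"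
    unfolding exp_family_def measurable_cong_sets[OF prior(1) refl] by measurable
  note posterior = prob_space_posterior[where \<pi> = \<pi> and p = p and x = x, OF this p_eq posterior_exists]
  have AE_N2: "AE \<eta> in post. fst \<eta> \<in> N2"
    unfolding post_def using prior(2) by (intro posterior(2)) (auto simp: N2_def elim: eventually_mono)
  interpret P: prob_space post
    unfolding post_def by (rule posterior(1))
  interpret Y: sigma_finite_measure \<mu>2 by (rule sigma_finite(2))
  interpret E: exp_family_posterior post \<mu>2 h2 t1 c2'
  proof
    show "prob_density \<mu>2 (exp_family h2 t1 c2' \<theta>)" if "\<theta> \<in> natural_params \<mu>2 h2 t1" for \<theta>
      using q_density[OF that] q_eq[of \<theta>] that by (simp add: N2_def q'_def)
    show "c2' \<in> borel_measurable borel"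
      unfolding c2'_def by (rule borel_measurable_log_partition[OF sigma_finite(2) h2(1) t1])
  qed (use h2 t1 AE_N2 expectation_exists in \<open>auto simp: N2_def\<close>)
  have mean: "q \<eta>1_hat = q' E.post_mean"
    using q_eq[of E.post_mean] E.post_mean_natural by (simp add: \<eta>1_hat_def E.post_mean_def N2_def)
  have loss: "posterior_expected_loss post \<mu>2 q r = posterior_expected_loss post \<mu>2 q' r" for r
    by (rule posterior_expected_loss_cong) (use AE_N2 in \<open>eventually_elim, simp add: q_eq\<close>)
  then have bayes: "bayes_predictive_density post \<mu>2 q r \<longleftrightarrow> bayes_predictive_density post \<mu>2 q' r" for r
    by (simp add: bayes_predictive_density_def)
  show ?thesis
    unfolding mean loss bayes
    using E.bayes_post_mean E.bayes_unique by (auto simp: q'_def)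
qed

end
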